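(* Let $n\ge1$, $0\le k\le n$, let $d=\gcd(n,k)$, and put $n'=n/d$, $k'=k/d$. Then an optimal scheme for the $(n,k)$-problem defined by an $n\times m$ binary matrix exists if and only if $m=rn'$ for some integer $r\ge1$, in which case each traveller cycles exactly $l=rk'$ of the $m$ stages.
   Context: The $(n,k)$-problem: $n$ travellers share $k$ bicycles and must all reach the end of a route as soon as possible (minimising the time of the last arrival); all start together at time $0$, every traveller walks at the same speed $w$ and cycles at the same speed $v>w$, changing mode takes no time, bicycles start at the beginning of the route and move only when ridden by a single rider. For a positive integer $m$, the route is divided by posts $P_0,\dots,P_m$ into $m$ equal stages $s_1,\dots,s_m$; an $n\times m$ binary matrix $M=(m_{i,j})$ defines a scheme in which traveller $t_i$ cycles $s_j$ if $m_{i,j}=1$ and walks it otherwise, a traveller due to cycle $s_j$ having to take a bicycle present at $P_{j-1}$ when he arrives there. Such a scheme is optimal if every traveller cycles exactly the fraction $k/n$ of the route and the scheme can be executed with the $k$ bicycles without any traveller ever having to wait for a bicycle (so all travellers arrive simultaneously in the least possible time). *)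

theory Defs
  imports Complex_Main "Jordan_Normal_Form.Matrix"
begin

text \<open>Indices are zero-based: traveller \<open>i < n\<close>, post \<open>j \<le> m\<close>, and stage \<open>j < m\<close>, which runs from
  post \<open>j\<close> to post \<open>j + 1\<close>.  The parameters \<open>D\<close>, \<open>w\<close>, \<open>v\<close> are the length of the route, the
  walking speed and the cycling speed.\<close>

definition binary_matrix :: "nat \<Rightarrow> nat \<Rightarrow> nat mat \<Rightarrow> bool" where
  "binary_matrix n m M \<longleftrightarrow>
     M \<in> carrier_mat n m \<and> (\<forall>i<n. \<forall>j<m. M $$ (i, j) \<in> {0, 1})"

definition cycles :: "nat mat \<Rightarrow> nat \<Rightarrow> nat \<Rightarrow> bool" where
  "cycles M i j \<longleftrightarrow> M $$ (i, j) = 1"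

definition cycled_stages :: "nat mat \<Rightarrow> nat \<Rightarrow> nat set" where
  "cycled_stages M i = {j. j < dim_col M \<and> cycles M i j}"

text \<open>The time at which traveller \<open>i\<close> reaches post \<open>j\<close> when he never waits.\<close>

definition arrival :: "real \<Rightarrow> real \<Rightarrow> real \<Rightarrow> nat mat \<Rightarrow> nat \<Rightarrow> nat \<Rightarrow> real" where
  "arrival D w v M i j =
     (\<Sum>q<j. (D / real (dim_col M)) / (if cycles M i q then v else w))"

text \<open>\<open>b i j\<close> is the bicycle that traveller \<open>i\<close> rides on stage \<open>j\<close>; it is meaningless if he walks
  that stage.  Travellers, and hence bicycles, only move forward, so a bicycle traverses a stage at
  most once and has at most one rider there.  All bicycles are at post \<open>0\<close> at time \<open>0\<close>; a bicycle
  is at a later post only if somebody has ridden it over the preceding stage.  The non-strict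
  inequality includes a traveller who stays on his bicycle (\<open>i' = i\<close>) and one who takes over a
  bicycle arriving at the same instant as himself.\<close>

definition executes_without_waiting ::
    "real \<Rightarrow> real \<Rightarrow> real \<Rightarrow> nat \<Rightarrow> nat mat \<Rightarrow> (nat \<Rightarrow> nat \<Rightarrow> nat) \<Rightarrow> bool" where
  "executes_without_waiting D w v k M b \<longleftrightarrow>
     (\<forall>i < dim_row M. \<forall>j < dim_col M. cycles M i j \<longrightarrow> b i j < k) \<and>
     (\<forall>i < dim_row M. \<forall>i' < dim_row M. \<forall>j < dim_col M.
        cycles M i j \<and> cycles M i' j \<and> b i j = b i' j \<longrightarrow> i = i') \<and>
     (\<forall>i < dim_row M. \<forall>j. Suc j < dim_col M \<and> cycles M i (Suc j) \<longrightarrow>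
        (\<exists>i' < dim_row M. cycles M i' j \<and> b i' j = b i (Suc j) \<and>
           arrival D w v M i' (Suc j) \<le> arrival D w v M i (Suc j)))"

definition optimal_scheme ::
    "real \<Rightarrow> real \<Rightarrow> real \<Rightarrow> nat \<Rightarrow> nat \<Rightarrow> nat \<Rightarrow> nat mat \<Rightarrow> bool" where
  "optimal_scheme D w v n k m M \<longleftrightarrow>
     binary_matrix n m M \<and>
     (\<forall>i<n. real (card (cycled_stages M i)) / real m = real k / real n) \<and>
     (\<exists>b. executes_without_waiting D w v k M b)"

end

theory Submission imports Defs "HOL-Number_Theory.Cong"
begin

text \<open>Comparing the cycled fractions gives \<open>n * l = k * m\<close>, hence \<open>n' dvd m\<close> by coprimality.
  Conversely, split the travellers into \<open>d\<close> groups of \<open>n'\<close>, each with \<open>k'\<close> bicycles, and let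
  traveller \<open>i\<close> cycle stage \<open>j\<close> iff \<open>(i + j) mod n' < k'\<close>.  At every post each group has one rider
  who dismounts and one who mounts. The residues traversed so far end at \<open>k' - 1\<close> for the former
  and at \<open>n' - 1\<close> for the latter, so the former has cycled at least as many stages and is there
  no later.\<close>

section \<open>Counting residues below a bound in windows of consecutive numbers\<close>

definition residue_count :: "nat \<Rightarrow> nat \<Rightarrow> nat \<Rightarrow> nat" where
  "residue_count N k x = (\<Sum>y<x. of_bool (y mod N < k))"

lemma residue_count_Suc:
  "residue_count N k (Suc x) = residue_count N k x + of_bool (x mod N < k)"
  by (simp add: residue_count_def)

lemma residue_count_mono: "x \<le> y \<Longrightarrow> residue_count N k x \<le> residue_count N k y"
  unfolding residue_count_def by (rule sum_mono2) auto

lemma residue_count_add_le: "residue_count N k (x + s) \<le> residue_count N k x + s"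
  by (induction s) (auto simp: residue_count_Suc)

text \<open>From a multiple of \<open>N\<close> the residues run through 0, 1, 2, ..., so those
  below \<open>k\<close> come first.\<close>

lemma residue_count_within_period:
  assumes "N dvd x" "s \<le> N"
  shows "residue_count N k (x + s) = residue_count N k x + min s k"
  using assms(2)
proof (induction s)
  case (Suc s)
  then have "(x + s) mod N = s"
    using assms(1) by (auto elim!: dvdE)
  with Suc show ?case
    by (auto simp: residue_count_Suc min_def)
qed simp

text \<open>Moving a window of length \<open>N\<close> by one step drops a residue and gains the
  same one, so the window starting at 0 decides.\<close>

lemma residue_count_add_period:
  assumes "k \<le> N"
  shows "residue_count N k (x + N) = residue_count N k x + k"
proof (induction x)
  case 0
  show ?case
    using residue_count_within_period[of N 0 N k] assms by (simp add: residue_count_def)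
qed (simp add: residue_count_Suc)

lemma residue_count_add_periods:
  assumes "k \<le> N"
  shows "residue_count N k (x + r * N) = residue_count N k x + r * k"
proof (induction r)
  case (Suc r)
  have "residue_count N k (x + Suc r * N) = residue_count N k ((x + r * N) + N)"
    by (simp add: algebra_simps)
  with Suc show ?case
    by (simp add: residue_count_add_period[OF assms])
qed simp

text \<open>Turns the number of stages that traveller \<open>i\<close> cycles before post
  \<open>L\<close> into a difference of cumulative counts.\<close>

lemma sum_of_bool_window:
  "(\<Sum>q<L. of_bool ((i + q) mod N < k)) = residue_count N k (i + L) - residue_count N k i"
  by (induction L) (auto simp: residue_count_Suc Suc_diff_le residue_count_mono)

section \<open>The cyclic scheme: cycled stages, arrival times and bicycles\<close>

definition cyclic_scheme :: "nat \<Rightarrow> nat \<Rightarrow> nat \<Rightarrow> nat \<Rightarrow> nat mat" where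
  "cyclic_scheme n m N k = mat n m (\<lambda>(i, j). of_bool ((i + j) mod N < k))"

lemma dim_cyclic_scheme [simp]:
  "dim_row (cyclic_scheme n m N k) = n" "dim_col (cyclic_scheme n m N k) = m"
  by (simp_all add: cyclic_scheme_def)

lemma binary_matrix_cyclic_scheme: "binary_matrix n m (cyclic_scheme n m N k)"
  by (auto simp: binary_matrix_def cyclic_scheme_def)

lemma cycles_cyclic_scheme:
  "i < n \<Longrightarrow> j < m \<Longrightarrow> cycles (cyclic_scheme n m N k) i j \<longleftrightarrow> (i + j) mod N < k"
  by (simp add: cycles_def cyclic_scheme_def)

lemma card_cycled_stages_cyclic_scheme:
  assumes "k \<le> N" "i < n"
  shows "card (cycled_stages (cyclic_scheme n (r * N) N k) i) = r * k"
proof -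
  have "cycled_stages (cyclic_scheme n (r * N) N k) i = {..<r * N} \<inter> {j. (i + j) mod N < k}"
    using assms(2) by (auto simp: cycled_stages_def cycles_cyclic_scheme)
  then have "card (cycled_stages (cyclic_scheme n (r * N) N k) i) =
      (\<Sum>q<r * N. of_bool ((i + q) mod N < k))"
    by simp
  then show ?thesis
    by (simp add: sum_of_bool_window residue_count_add_periods[OF assms(1)])
qed

text \<open>Cycling a stage saves the same time \<open>s\<close> everywhere, so the arrival depends
  only on how many of the preceding stages were cycled.\<close>

lemma arrival_mono:
  assumes "D > 0" "0 < w" "w < v"
    and "(\<Sum>q<j. of_bool (cycles M i q)) \<le> (\<Sum>q<j. of_bool (cycles M i' q) :: nat)"
  shows "arrival D w v M i' j \<le> arrival D w v M i j"
proof -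
  define c where "c = D / real (dim_col M)"
  define s where "s = c / w - c / v"
  have "c \<ge> 0"
    using assms(1) by (simp add: c_def)
  then have "s \<ge> 0"
    using assms(2,3) by (simp add: s_def frac_le)
  have arrival: "arrival D w v M a j =
      real j * (c / w) - s * real (\<Sum>q<j. of_bool (cycles M a q))" for a
  proof -
    have "arrival D w v M a j = (\<Sum>q<j. c / w - s * of_bool (cycles M a q))"
      unfolding arrival_def by (rule sum.cong) (auto simp: c_def s_def)
    then show ?thesis
      by (simp add: sum_subtractf sum_distrib_left del: sum_of_bool_eq)
  qed
  show ?thesis
    unfolding arrival
    by (intro diff_left_mono mult_left_mono of_nat_mono assms(4) \<open>s \<ge> 0\<close>)
qed

text \<open>The member of the group of \<open>i\<close> whose residue is ahead by \<open>k\<close>: he reaches residue \<open>k\<close>, and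
  dismounts, where \<open>i\<close> reaches residue \<open>0\<close> and mounts.\<close>

definition dismounter :: "nat \<Rightarrow> nat \<Rightarrow> nat \<Rightarrow> nat" where
  "dismounter N k i = (if i mod N + k < N then i + k else i + k - N)"

lemma dismounter_div:
  assumes "k \<le> N" "N > 0"
  shows "dismounter N k i div N = i div N"
proof (rule div_nat_eqI)
  have i: "N * (i div N) + i mod N = i" and less: "i mod N < N"
    using assms(2) by simp_all
  show "N * (i div N) \<le> dismounter N k i"
    unfolding dismounter_def using i by (split if_split) linarith
  show "dismounter N k i < N * Suc (i div N)"
    unfolding dismounter_def mult_Suc_right using i less assms(1) by (split if_split) linarith
qed

lemma dismounter_add_mod:
  assumes "k \<le> N" "N > 0"
  shows "(dismounter N k i + x) mod N = (i + x + k) mod N"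
proof (cases "i mod N + k < N")
  case False
  have "N \<le> i + k"
    using False mod_less_eq_dividend[of i N] by linarith
  then have eq: "dismounter N k i + x + N = i + x + k"
    using False by (simp add: dismounter_def)
  show ?thesis
    using mod_add_self2[of "dismounter N k i + x" N] unfolding eq by simp
qed (simp add: dismounter_def ac_simps)

text \<open>A shift by \<open>k\<close> adds exactly \<open>k\<close> to the cumulative count at the
  end of the window, because \<open>i + L\<close> starts a period, and at most \<open>k\<close> at
  its start. If the shift wraps around, subtracting \<open>N\<close> takes this \<open>k\<close> off
  the end again and puts the start at or before \<open>i\<close>.\<close>

lemma dismounter_window:
  assumes "k \<le> N" and "N dvd i + L"
  shows "residue_count N k (i + L) - residue_count N k i \<le>
    residue_count N k (dismounter N k i + L) - residue_count N k (dismounter N k i)"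
proof -
  let ?C = "residue_count N k" and ?e = "dismounter N k i"
  have *: "?C (i + L + k) = ?C (i + L) + k"
    using residue_count_within_period[OF assms(2,1), of k] by simp
  show ?thesis
  proof (cases "i mod N + k < N")
    case True
    then have "?e = i + k"
      by (simp add: dismounter_def)
    moreover have "?C (i + k) \<le> ?C i + k"
      by (rule residue_count_add_le)
    ultimately show ?thesis
      using * by (simp add: ac_simps)
  next
    case False
    have "N \<le> i + k"
      using False mod_less_eq_dividend[of i N] by linarith
    then have eq: "?e + L + N = i + L + k"
      using False by (simp add: dismounter_def)
    have "?C (?e + L) = ?C (i + L)"
      using * residue_count_add_period[OF assms(1), of "?e + L"] unfolding eq by simp
    moreover have "?C ?e \<le> ?C i"
      using False assms(1) by (intro residue_count_mono) (simp add: dismounter_def)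
    ultimately show ?thesis
      by simp
  qed
qed

text \<open>A bicycle stays with its rider, whose residue \<open>(i + j) mod N\<close> increases by one per stage,
  and passes from residue \<open>k - 1\<close> to residue \<open>0\<close>; so residue minus \<open>j\<close> modulo \<open>k\<close> identifies it
  within its group.\<close>

definition cyclic_bicycle :: "nat \<Rightarrow> nat \<Rightarrow> nat \<Rightarrow> nat \<Rightarrow> nat" where
  "cyclic_bicycle N k i j = i div N * k + ((i + j) mod N + j * (k - 1)) mod k"

lemma cyclic_bicycle_less:
  assumes "k > 0" "i < d * N"
  shows "cyclic_bicycle N k i j < d * k"
proof -
  have "i div N < d"
    using assms(2) by (simp add: less_mult_imp_div_less)
  then have "Suc (i div N) * k \<le> d * k"
    by (intro mult_le_mono1) simp
  moreover have "((i + j) mod N + j * (k - 1)) mod k < k"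
    using assms(1) by simp
  ultimately show ?thesis
    unfolding cyclic_bicycle_def by simp
qed

text \<open>Division by \<open>k\<close> recovers the group. Residues below \<open>k\<close> that
  agree modulo \<open>k\<close> are equal, and group and residue determine the traveller.\<close>

lemma cyclic_bicycle_inj:
  assumes "(i + j) mod N < k" "(i' + j) mod N < k"
    and eq: "cyclic_bicycle N k i j = cyclic_bicycle N k i' j"
  shows "i = i'"
proof -
  have "k > 0" using assms(1) by simp
  have div_eq: "i div N = i' div N"
    using arg_cong[OF eq, of "\<lambda>x. x div k"] \<open>k > 0\<close> by (simp add: cyclic_bicycle_def)
  have "[(i + j) mod N + j * (k - 1) = (i' + j) mod N + j * (k - 1)] (mod k)"
    using eq div_eq by (simp add: cyclic_bicycle_def unique_euclidean_semiring_class.cong_def)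
  then have "(i + j) mod N = (i' + j) mod N"
    using assms(1,2) by (simp add: cong_add_rcancel_nat cong_less_modulus_unique_nat)
  then have "i mod N = i' mod N"
    by (metis cong_add_rcancel_nat unique_euclidean_semiring_class.cong_def)
  with div_eq show ?thesis
    by (metis div_mult_mod_eq)
qed

lemma cyclic_scheme_executes:
  assumes "k \<le> N" "N > 0" "D > 0" "0 < w" "w < v"
  shows "executes_without_waiting D w v (d * k) (cyclic_scheme (d * N) m N k) (cyclic_bicycle N k)"
proof -
  let ?M = "cyclic_scheme (d * N) m N k" and ?b = "cyclic_bicycle N k"
  have handover: "\<exists>i'<d * N. cycles ?M i' j \<and> ?b i' j = ?b i (Suc j) \<and>
      arrival D w v ?M i' (Suc j) \<le> arrival D w v ?M i (Suc j)"
    if i: "i < d * N" and j: "Suc j < m" and cyc: "cycles ?M i (Suc j)" for i j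
  proof -
    have less: "(i + Suc j) mod N < k"
      using cyc i j by (simp add: cycles_cyclic_scheme)
    then have "k > 0" by simp
    show ?thesis
    proof (cases "(i + Suc j) mod N = 0")
      case False
      then have eq: "(i + Suc j) mod N = Suc ((i + j) mod N)"
        by (simp add: mod_Suc split: if_splits)
      \<comment> \<open>The factor \<open>k - 1\<close> acts as -1 modulo \<open>k\<close>: residue
        and correction together grow by \<open>k\<close>, so the rider keeps his bicycle.\<close>
      have "Suc ((i + j) mod N) + Suc j * (k - 1) = (i + j) mod N + j * (k - 1) + k"
        using \<open>k > 0\<close> by simp
      then have "?b i j = ?b i (Suc j)"
        unfolding cyclic_bicycle_def eq by (simp only: mod_add_self2)
      moreover have "cycles ?M i j"
        using less eq i j by (simp add: cycles_cyclic_scheme)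
      ultimately show ?thesis
        using i by blast
    next
      case True
      define i' where "i' = dismounter N k i"
      have div_eq: "i' div N = i div N"
        unfolding i'_def using assms by (intro dismounter_div)
      have i': "i' < d * N"
        using div_eq i assms(2) by (metis div_less_iff_less_mult)
      have "(i' + j) mod N = (i + j + k) mod N"
        unfolding i'_def using assms by (intro dismounter_add_mod)
      also have "i + j + k = (i + Suc j) + (k - 1)"
        using \<open>k > 0\<close> by simp
      also have "\<dots> mod N = (k - 1) mod N"
        using True by (metis add_0 mod_add_left_eq)
      finally have mod_eq: "(i' + j) mod N = k - 1"
        using \<open>k > 0\<close> assms(1) by simp
      \<comment> \<open>Within the group, \<open>k - 1 + j * (k - 1)\<close> equals
        \<open>0 + Suc j * (k - 1)\<close>: last residue cycled against first.\<close>
      have "?b i' j = ?b i (Suc j)"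
        unfolding cyclic_bicycle_def div_eq mod_eq True by simp
      moreover have "cycles ?M i' j"
        using i' j mod_eq \<open>k > 0\<close> by (simp add: cycles_cyclic_scheme)
      moreover have "arrival D w v ?M i' (Suc j) \<le> arrival D w v ?M i (Suc j)"
      proof (rule arrival_mono[OF assms(3-5)])
        have count: "(\<Sum>q<Suc j. of_bool (cycles ?M a q)) =
            residue_count N k (a + Suc j) - residue_count N k a" if "a < d * N" for a
          unfolding sum_of_bool_window[symmetric]
          using that j by (intro sum.cong) (auto simp: cycles_cyclic_scheme)
        \<comment> \<open>Residue 0 says that \<open>N\<close> divides \<open>i + Suc j\<close>,
          which is what the comparison of windows requires.\<close>
        show "(\<Sum>q<Suc j. of_bool (cycles ?M i q)) \<le> (\<Sum>q<Suc j. of_bool (cycles ?M i' q) :: nat)"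
          unfolding count[OF i] count[OF i'] unfolding i'_def
          using True assms(1) by (intro dismounter_window) auto
      qed
      ultimately show ?thesis
        using i' by blast
    qed
  qed
  show ?thesis
    unfolding executes_without_waiting_def dim_cyclic_scheme
  proof (intro conjI)
    show "\<forall>i<d * N. \<forall>j<m. cycles ?M i j \<longrightarrow> ?b i j < d * k"
      by (auto simp: cycles_cyclic_scheme intro!: cyclic_bicycle_less)
    show "\<forall>i<d * N. \<forall>i'<d * N. \<forall>j<m. cycles ?M i j \<and> cycles ?M i' j \<and> ?b i j = ?b i' j \<longrightarrow> i = i'"
      by (auto simp: cycles_cyclic_scheme dest: cyclic_bicycle_inj)
    show "\<forall>i<d * N. \<forall>j. Suc j < m \<and> cycles ?M i (Suc j) \<longrightarrow>
        (\<exists>i'<d * N. cycles ?M i' j \<and> ?b i' j = ?b i (Suc j) \<and>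
          arrival D w v ?M i' (Suc j) \<le> arrival D w v ?M i (Suc j))"
      using handover by blast
  qed
qed

theorem theorem6p4:
  fixes n k d n' k' m :: nat and D w v :: real
  assumes "n \<ge> 1" and "k \<le> n"
    and "d = gcd n k" and "n' = n div d" and "k' = k div d"
    and "D > 0" and "0 < w" and "w < v"
    and "m \<ge> 1"
  shows "((\<exists>M. optimal_scheme D w v n k m M) \<longleftrightarrow> (\<exists>r\<ge>1. m = r * n')) \<and>
    (\<forall>r\<ge>1. m = r * n' \<longrightarrow>
       (\<forall>M. optimal_scheme D w v n k m M \<longrightarrow>
          (\<forall>i<n. card (cycled_stages M i) = r * k')))"
proof -
  have d: "d > 0" and n: "n = d * n'" and k: "k = d * k'"
    using assms(1,3-5) by auto
  have n': "n' > 0" and k': "k' \<le> n'"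
    using assms(1,2) d n k by auto
  have coprime: "coprime n' k'"
    using assms(1,3-5) by (simp add: div_gcd_coprime)
  have card_eq: "n' * card (cycled_stages M i) = k' * m"
    if "optimal_scheme D w v n k m M" "i < n" for M i
  proof -
    have "real (card (cycled_stages M i)) / real m = real k' / real n'"
      using that d by (simp add: optimal_scheme_def n k)
    then have "real (n' * card (cycled_stages M i)) = real (k' * m)"
      using n' assms(9) by (simp add: field_simps)
    then show ?thesis
      by (simp only: of_nat_eq_iff)
  qed
  have "\<exists>r\<ge>1. m = r * n'" if "optimal_scheme D w v n k m M" for M
  proof -
    \<comment> \<open>One row suffices for the divisibility; traveller 0 exists because
      \<open>n \<ge> 1\<close>.\<close>
    have "n' dvd k' * m"
      using card_eq[OF that, of 0] assms(1) by (intro dvdI[of _ _ "card (cycled_stages M 0)"]) simp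
    then have "n' dvd m"
      using coprime by (simp add: coprime_dvd_mult_right_iff)
    then obtain r where "m = r * n'"
      by (auto simp: dvd_def mult.commute)
    then show ?thesis
      \<comment> \<open>The case \<open>r = 0\<close> would give \<open>m = 0\<close>.\<close>
      using assms(9) by (cases r) auto
  qed
  moreover have "optimal_scheme D w v n k m (cyclic_scheme n m n' k')"
    if "m = r * n'" "r \<ge> 1" for r
    unfolding optimal_scheme_def
  proof (intro conjI)
    show "binary_matrix n m (cyclic_scheme n m n' k')"
      by (rule binary_matrix_cyclic_scheme)
    show "\<forall>i<n. real (card (cycled_stages (cyclic_scheme n m n' k') i)) / real m = real k / real n"
      using that d n' by (simp add: card_cycled_stages_cyclic_scheme[OF k'] n k)
    show "\<exists>b. executes_without_waiting D w v k (cyclic_scheme n m n' k') b"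
      using cyclic_scheme_executes[OF k' n' assms(6-8)] unfolding n k by blast
  qed
  moreover have "card (cycled_stages M i) = r * k'"
    if "m = r * n'" "optimal_scheme D w v n k m M" "i < n" for r M i
    using card_eq[OF that(2,3)] that(1) n' by simp
  ultimately show ?thesis
    by blast
qed

end
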